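(* Let $n \ge m$ and $1 \le k \le m$, and let $\gamma > 1$ be an approximation factor, possibly depending on $k$, $n$, and $m$. For $A \in \mathbb{R}^{m \times n}$ let $A_k$ denote the best rank-$k$ approximation to $A$. Suppose a randomized, adaptive algorithm with access to the input matrix $A$ only through the oracle $x \mapsto Ax$ outputs a matrix $\widetilde{A}$ of rank at most $k$ satisfying $$\|A - \widetilde{A}\|_F \le \gamma \cdot \|A - A_k\|_F$$ with probability at least $\tfrac{2}{3}$ for every $A \in \mathbb{R}^{m\times n}$. Then the algorithm must use at least $n$ forward matrix-vector products.
   Context: $\|\cdot\|_F$ is the Frobenius norm. $A_k$ is the best approximation to $A$ of rank at most $k$ given by the Eckart--Young theorem (truncated SVD). Query model: the unknown matrix $A \in \mathbb{R}^{m \times n}$ is accessed only through an oracle that returns $Ax$ for any query vector $x \in \mathbb{R}^n$ (a forward matrix-vector product); there is no access to $A^\top$ or to the entries of $A$. An algorithm using $q$ queries chooses $x_1, \dots, x_q \in \mathbb{R}^n$ adaptively, each $x_i$ depending (measurably) on the previous queries and responses and on internal randomness independent of $A$; after observing the transcript $(x_1, Ax_1), \dots, (x_q, Ax_q)$ it outputs a matrix that is a (measurable) function of the transcript and the internal randomness. Internal computation is unrestricted. A deterministic algorithm is one that uses no internal randomness. *)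

theory Defs
  imports "HOL-Probability.Probability"
begin

definition frobenius_norm :: "real^'n^'m \<Rightarrow> real" where
  "frobenius_norm A = sqrt (\<Sum>i\<in>UNIV. \<Sum>j\<in>UNIV. (A $ i $ j)\<^sup>2)"

lemma frobenius_norm_eq_norm: "frobenius_norm A = norm A"
  by (simp add: frobenius_norm_def norm_vec_def L2_set_def sum_nonneg)

definition is_best_rank_approx :: "nat \<Rightarrow> real^'n^'m \<Rightarrow> real^'n^'m \<Rightarrow> bool" where
  "is_best_rank_approx k A B \<longleftrightarrow> rank B \<le> k \<and>
     (\<forall>C. rank C \<le> k \<longrightarrow> frobenius_norm (A - B) \<le> frobenius_norm (A - C))"

text \<open>
  When singular values coincide, the minimiser need not be unique; one is fixed by choice.
  Existence and independence of the error from the choice are proved below.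
\<close>

definition best_rank_approx :: "nat \<Rightarrow> real^'n^'m \<Rightarrow> real^'n^'m" where
  "best_rank_approx k A = (SOME B. is_best_rank_approx k A B)"

lemma norm_matrix_vector_mult_le:
  fixes M :: "real^'n^'m"
  shows "norm (M *v x) \<le> norm M * norm x"
proof -
  have "norm (M *v x) = L2_set (\<lambda>i. norm ((M *v x) $ i)) UNIV"
    by (simp add: norm_vec_def)
  also have "\<dots> \<le> L2_set (\<lambda>i. norm (M $ i) * norm x) UNIV"
    by (intro L2_set_mono)
      (auto simp: matrix_vector_mul_component Cauchy_Schwarz_ineq2)
  also have "\<dots> = norm M * norm x"
    by (simp add: norm_vec_def[of M] L2_set_left_distrib)
  finally show ?thesis .
qed

lemma rank_le_if_near:
  fixes A :: "real^'n^'m"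
  obtains e where "e > 0" "\<And>B. norm (B - A) < e \<Longrightarrow> rank A \<le> rank B"
proof -
  define S where "S = span (rows A)"
  have S: "subspace S" "closed S" "dim S = rank A"
    by (auto simp: S_def row_rank_def closed_subspace)
  have inj: "x = 0" if "x \<in> S" "A *v x = 0" for x
  proof -
    have "r \<bullet> x = 0" if "r \<in> rows A" for r
      using that \<open>A *v x = 0\<close>
      by (auto simp: rows_def row_def vec_lambda_eta vec_eq_iff[of "A *v x"] matrix_vector_mul_component)
    then have "\<forall>y\<in>S. orthogonal x y"
      using orthogonal_to_span[of _ "rows A" x]
      by (auto simp: S_def orthogonal_def inner_commute)
    with that show "x = 0" by (auto simp: orthogonal_def)
  qed
  obtain e where e: "e > 0" "\<And>x. x \<in> S \<Longrightarrow> e * norm x \<le> norm (A *v x)"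
    using injective_imp_isometric[OF S(2,1), of "(*v) A"] inj
    by (auto simp: matrix_vector_mul_bounded_linear)
  have "rank A \<le> rank B" if B: "norm (B - A) < e" for B
  proof -
    have z: "x = 0" if x: "x \<in> S" "B *v x = 0" for x
    proof (rule ccontr)
      assume "x \<noteq> 0"
      have "e * norm x \<le> norm (A *v x)" using e x by simp
      also have "\<dots> = norm ((B - A) *v x)"
        using x by (simp add: matrix_vector_mult_diff_rdistrib)
      also have "\<dots> \<le> norm (B - A) * norm x"
        by (rule norm_matrix_vector_mult_le)
      also have "\<dots> < e * norm x"
        using B \<open>x \<noteq> 0\<close> by simp
      finally show False by simp
    qed
    have "inj_on ((*v) B) S"
    proof (rule inj_onI)
      fix x y assume "x \<in> S" "y \<in> S" "B *v x = B *v y"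
      then show "x = y"
        using z[of "x - y"] S(1) by (simp add: matrix_vector_mult_diff_distrib subspace_diff)
    qed
    then have d: "dim ((*v) B ` S) = dim S"
      using S(1) by (intro dim_image_eq) (auto simp: span_eq_iff[THEN iffD2])
    have "dim ((*v) B ` S) \<le> dim (range ((*v) B))"
      by (intro dim_subset) auto
    with d show ?thesis by (simp add: S flip: rank_dim_range)
  qed
  with e(1) that show thesis by blast
qed

lemma closed_rank_le: "closed {A :: real^'n^'m. rank A \<le> k}"
proof -
  have "open (- {A :: real^'n^'m. rank A \<le> k})"
    unfolding open_dist
  proof (intro ballI)
    fix A :: "real^'n^'m" assume A: "A \<in> - {A. rank A \<le> k}"
    obtain e where "e > 0" "\<And>B. norm (B - A) < e \<Longrightarrow> rank A \<le> rank B"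
      using rank_le_if_near[of A] by blast
    with A show "\<exists>e>0. \<forall>y. dist y A < e \<longrightarrow> y \<in> - {A. rank A \<le> k}"
      by (fastforce simp: dist_norm intro!: exI[of _ e])
  qed
  then show ?thesis by (simp add: closed_def)
qed

lemma is_best_rank_approx_best_rank_approx:
  fixes A :: "real^'n^'m"
  shows "is_best_rank_approx k A (best_rank_approx k A)"
proof -
  have "(0 :: real^'n^'m) \<in> {B. rank B \<le> k}" by simp
  then have ne: "{B :: real^'n^'m. rank B \<le> k} \<noteq> {}" by blast
  obtain B where "B \<in> {B :: real^'n^'m. rank B \<le> k}"
    "\<And>C. C \<in> {B. rank B \<le> k} \<Longrightarrow> dist A B \<le> dist A C"
    using distance_attains_inf[OF closed_rank_le ne] by metis
  then have "is_best_rank_approx k A B"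
    by (auto simp: is_best_rank_approx_def frobenius_norm_eq_norm dist_norm)
  then show ?thesis
    unfolding best_rank_approx_def by (rule someI)
qed

lemma is_best_rank_approx_error:
  "is_best_rank_approx k A B \<Longrightarrow>
     frobenius_norm (A - B) = frobenius_norm (A - best_rank_approx k A)"
  using is_best_rank_approx_best_rank_approx[of k A]
  by (auto simp: is_best_rank_approx_def intro!: antisym)

text \<open>
  A transcript of length i is a function on the indices below i, undefined elsewhere, so that it
  is a point of the product space over those indices.
\<close>

type_synonym ('m, 'n) transcript = "nat \<Rightarrow> (real^'n) \<times> (real^'m)"

definition transcript_space :: "nat \<Rightarrow> ('m::finite, 'n::finite) transcript measure" where
  "transcript_space i = PiM {..<i} (\<lambda>_. borel \<Otimes>\<^sub>M borel)"

text \<open>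
  The maps take the seed first; \<open>next_query alg i\<close> chooses query number i (counted from 0) from
  the transcript of the i preceding ones. The input matrix is not an argument, and the seed
  distribution does not depend on it.
\<close>

record ('s, 'm, 'n) matvec_alg =
  seed :: "'s measure"
  num_queries :: nat
  next_query :: "nat \<Rightarrow> 's \<Rightarrow> ('m::finite, 'n::finite) transcript \<Rightarrow> real^'n"
  answer :: "'s \<Rightarrow> ('m, 'n) transcript \<Rightarrow> real^'n^'m"

definition randomized_matvec_alg :: "('s, 'm::finite, 'n::finite) matvec_alg \<Rightarrow> bool" where
  "randomized_matvec_alg alg \<longleftrightarrow>
     prob_space (seed alg) \<and>
     (\<forall>i < num_queries alg.
        (\<lambda>(s, t). next_query alg i s t) \<in> seed alg \<Otimes>\<^sub>M transcript_space i \<rightarrow>\<^sub>M borel) \<and>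
     (\<lambda>(s, t). answer alg s t) \<in> seed alg \<Otimes>\<^sub>M transcript_space (num_queries alg) \<rightarrow>\<^sub>M borel"

primrec run_transcript ::
  "('s, 'm::finite, 'n::finite) matvec_alg \<Rightarrow> real^'n^'m \<Rightarrow> 's \<Rightarrow> nat \<Rightarrow> ('m, 'n) transcript" where
  "run_transcript alg A s 0 = (\<lambda>_. undefined)"
| "run_transcript alg A s (Suc i) =
     (let t = run_transcript alg A s i; x = next_query alg i s t in t(i := (x, A *v x)))"

definition run_output ::
  "('s, 'm::finite, 'n::finite) matvec_alg \<Rightarrow> real^'n^'m \<Rightarrow> 's \<Rightarrow> real^'n^'m" where
  "run_output alg A s = answer alg s (run_transcript alg A s (num_queries alg))"

definition success_event ::
  "('s, 'm::finite, 'n::finite) matvec_alg \<Rightarrow> nat \<Rightarrow> real \<Rightarrow> real^'n^'m \<Rightarrow> 's set" where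
  "success_event alg k \<gamma> A =
     {s \<in> space (seed alg). rank (run_output alg A s) \<le> k \<and>
        frobenius_norm (A - run_output alg A s) \<le> \<gamma> * frobenius_norm (A - best_rank_approx k A)}"

lemma run_transcript_measurable:
  fixes alg :: "('s, 'm::finite, 'n::finite) matvec_alg"
  assumes "randomized_matvec_alg alg" "i \<le> num_queries alg"
  shows "(\<lambda>s. run_transcript alg A s i) \<in> seed alg \<rightarrow>\<^sub>M transcript_space i"
  using assms(2)
proof (induction i)
  case 0
  show ?case by (simp add: transcript_space_def space_PiM)
next
  case (Suc i)
  let ?t = "\<lambda>s. run_transcript alg A s i"
  have t: "?t \<in> seed alg \<rightarrow>\<^sub>M transcript_space i" using Suc by simp
  have q: "(\<lambda>(s, t). next_query alg i s t) \<in> seed alg \<Otimes>\<^sub>M transcript_space i \<rightarrow>\<^sub>M borel"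
    using assms(1) Suc.prems by (simp add: randomized_matvec_alg_def)
  have x: "(\<lambda>s. next_query alg i s (?t s)) \<in> seed alg \<rightarrow>\<^sub>M borel"
    using measurable_compose[OF measurable_Pair[OF measurable_ident t] q] by simp
  have "(*v) A \<in> borel \<rightarrow>\<^sub>M borel"
    by (intro borel_measurable_continuous_onI linear_continuous_on matrix_vector_mul_bounded_linear)
  note p = measurable_Pair[OF x measurable_compose[OF x this]]
  show ?case
    unfolding run_transcript.simps Let_def transcript_space_def
    by (rule measurable_fun_upd[where J = "{..<i}" and i = i])
      (use p t in \<open>auto simp: lessThan_Suc transcript_space_def\<close>)
qed

lemma run_output_measurable:
  fixes alg :: "('s, 'm::finite, 'n::finite) matvec_alg"
  assumes "randomized_matvec_alg alg"
  shows "run_output alg A \<in> seed alg \<rightarrow>\<^sub>M borel"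
proof -
  have "(\<lambda>(s, t). answer alg s t) \<in> seed alg \<Otimes>\<^sub>M transcript_space (num_queries alg) \<rightarrow>\<^sub>M borel"
    using assms by (simp add: randomized_matvec_alg_def)
  from measurable_compose[OF measurable_Pair[OF measurable_ident
      run_transcript_measurable[OF assms order_refl]] this]
  show ?thesis by (simp add: run_output_def[abs_def])
qed

lemma success_event_measurable:
  fixes alg :: "('s, 'm::finite, 'n::finite) matvec_alg"
  assumes "randomized_matvec_alg alg"
  shows "success_event alg k \<gamma> A \<in> sets (seed alg)"
proof -
  have "closed ({B. rank B \<le> k} \<inter>
      {B. norm (A - B) \<le> \<gamma> * frobenius_norm (A - best_rank_approx k A)})"
    by (intro closed_Int closed_rank_le closed_Collect_le continuous_intros)
  from measurable_sets[OF run_output_measurable[OF assms, of A] borel_closed[OF this]]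
  show ?thesis
    by (rule back_subst[where P = "\<lambda>S. S \<in> sets (seed alg)"])
      (auto simp: success_event_def frobenius_norm_eq_norm)
qed

end

theory Submission
  imports Defs
begin

text \<open>
  A matrix of rank at most \<open>k\<close> is its own best approximation, so the algorithm has to recover it
  exactly, whatever \<open>\<gamma>\<close> is. Take the matrices with a single nonzero row \<open>v\<close>: a query then reveals
  one inner product with \<open>v\<close>. For a fixed seed, fewer than \<open>n\<close> adaptively chosen inner products
  determine \<open>v\<close> only on a Lebesgue null set, because conditioning on each answer cuts the space of
  candidates by at most one dimension. By Fubini, almost every \<open>v\<close> is then recovered with
  probability zero.
\<close>

text \<open>\<open>adaptive r F\<close>: the value \<open>F v\<close> can be computed from \<open>r\<close> adaptive inner products with \<open>v\<close>.\<close>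

inductive adaptive :: "nat \<Rightarrow> ('a::euclidean_space \<Rightarrow> 'b) \<Rightarrow> bool" where
  const: "adaptive 0 (\<lambda>_. b)"
| query: "(\<And>c. adaptive r (G c)) \<Longrightarrow> adaptive (Suc r) (\<lambda>v. G (x \<bullet> v) v)"

section \<open>Lebesgue null sets and adaptive inner products\<close>

lemma AE_lborel_translate:
  fixes a :: "'a::euclidean_space"
  assumes "{x. P x} \<in> sets borel"
  shows "(AE x in lborel. P (a + x)) \<longleftrightarrow> (AE x in lborel. P x)"
proof -
  have "(AE x in lborel. P x) \<longleftrightarrow> (AE x in distr lborel borel ((+) a). P x)"
    unfolding lborel_distr_plus ..
  also have "\<dots> \<longleftrightarrow> (AE x in lborel. P (a + x))"
    using assms by (subst AE_distr_iff) auto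
  finally show ?thesis by simp
qed

text \<open>Division by zero makes this the identity at \<open>y = 0\<close>, so its values are
  orthogonal to \<open>y\<close> in every case.\<close>

definition proj_orth :: "'a::euclidean_space \<Rightarrow> 'a \<Rightarrow> 'a" where
  "proj_orth y g = g - ((y \<bullet> g) / (y \<bullet> y)) *\<^sub>R y"

lemma linear_proj_orth: "linear (proj_orth y)"
  by (rule linearI) (auto simp: proj_orth_def algebra_simps add_divide_distrib)

lemma inner_proj_orth: "y \<bullet> proj_orth y g = 0"
  by (cases "y = 0") (auto simp: proj_orth_def algebra_simps)

text \<open>Since \<open>g\<close> and \<open>proj_orth y g\<close> differ by a multiple of
  \<open>y\<close>, only the direction \<open>L y\<close> can be lost.\<close>

lemma dim_range_proj_orth:
  fixes L :: "'a::euclidean_space \<Rightarrow> 'b::euclidean_space"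
  assumes "linear L"
  shows "dim (range L) \<le> Suc (dim (range (L \<circ> proj_orth y)))"
proof -
  have "L g \<in> span (insert (L y) (range (L \<circ> proj_orth y)))" for g
  proof -
    have "L g = (L \<circ> proj_orth y) g + ((y \<bullet> g) / (y \<bullet> y)) *\<^sub>R L y"
      using assms by (simp add: proj_orth_def linear_diff linear_scale)
    then show ?thesis
      by (metis (no_types, lifting) insertCI rangeI span_add span_base span_scale)
  qed
  then have "dim (range L) \<le> dim (insert (L y) (range (L \<circ> proj_orth y)))"
    by (metis (no_types, lifting) dim_span dim_subset image_subset_iff)
  also have "\<dots> \<le> Suc (dim (range (L \<circ> proj_orth y)))"
    by (simp add: dim_insert)
  finally show ?thesis .
qed

text \<open>
  Sections are parametrised by all of the space through \<open>proj_orth y\<close>, so that no measure on the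
  hyperplane is needed. The proof applies Fubini twice, to the families \<open>proj_orth y g + t y\<close> and
  \<open>g + t y\<close>, which for fixed \<open>g\<close> differ by a shift of \<open>t\<close>.
\<close>

lemma AE_lborel_hyperplane_sections:
  fixes y :: "'a::euclidean_space"
  assumes E: "{g. P g} \<in> sets borel"
    and sections: "\<And>t. AE g in lborel. P (proj_orth y g + t *\<^sub>R y)"
  shows "AE g in lborel. P g"
proof -
  have [measurable]: "Measurable.pred borel P"
    using E by (simp add: pred_def)
  have [measurable]: "proj_orth y \<in> borel_measurable borel"
    by (intro borel_measurable_continuous_onI linear_continuous_on
      linear_conv_bounded_linear[THEN iffD1] linear_proj_orth)
  have [measurable]: "(\<lambda>p. proj_orth y (fst p) + snd p *\<^sub>R y) \<in> lborel \<Otimes>\<^sub>M lborel \<rightarrow>\<^sub>M borel"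
    by measurable
  have "Measurable.pred (lborel \<Otimes>\<^sub>M lborel) (\<lambda>p. P (proj_orth y (fst p) + snd p *\<^sub>R y))"
    by measurable
  then have "AE g in lborel. AE t in lborel. P (proj_orth y g + t *\<^sub>R y)"
    using sections by (subst lborel_pair.AE_commute) (simp_all add: pred_def)
  then have "AE g in lborel. AE t in lborel. P (g + t *\<^sub>R y)"
  proof eventually_elim
    case (elim g)
    have "AE t in lborel. P (proj_orth y g + ((y \<bullet> g) / (y \<bullet> y) + t) *\<^sub>R y)"
      using elim by (subst AE_lborel_translate) auto
    then show ?case
      by (simp add: proj_orth_def algebra_simps)
  qed
  moreover have "Measurable.pred (lborel \<Otimes>\<^sub>M lborel) (\<lambda>p. P (snd p + fst p *\<^sub>R y))"
    by measurable
  ultimately have "AE t in lborel. AE g in lborel. P (g + (t::real) *\<^sub>R y)"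
    by (subst lborel_pair.AE_commute) (simp_all add: pred_def)
  \<comment> \<open>Some \<open>t\<close> is good because \<open>lborel\<close> is not the null
    measure; one suffices, as \<open>g + t y\<close> is a translate of \<open>g\<close>.\<close>
  then obtain t :: real where "AE g in lborel. P (g + t *\<^sub>R y)"
    using eventually_happens[of _ "ae_filter lborel"] by (auto simp: ae_filter_eq_bot_iff)
  then show ?thesis
    using AE_lborel_translate[of P "t *\<^sub>R y"] E by (simp add: add.commute)
qed

text \<open>Pairing \<open>L g = b\<close> with a nonzero vector \<open>L h\<close> of the range
  leaves one scalar equation, which confines \<open>g\<close> to a hyperplane with normal
  \<open>adjoint L (L h)\<close>.\<close>

lemma AE_linear_neq:
  fixes L :: "'a::euclidean_space \<Rightarrow> 'b::euclidean_space"
  assumes L: "linear L" and "0 < dim (range L)"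
  shows "AE g in lborel. L g \<noteq> b"
proof -
  obtain h where h: "L h \<noteq> 0"
    using assms(2) by (metis dim_eq_0 image_subset_iff neq0_conv singletonI)
  define w where "w = adjoint L (L h)"
  have w: "g \<bullet> w = L g \<bullet> L h" for g
    using L by (simp add: w_def adjoint_works)
  with h have "w \<noteq> 0"
    by (metis inner_eq_zero_iff inner_zero_right)
  then have "negligible {g. w \<bullet> g = b \<bullet> L h}"
    by (intro negligible_hyperplane) auto
  then have "AE g in lebesgue. w \<bullet> g \<noteq> b \<bullet> L h"
    by (auto simp: negligible_iff_null_sets AE_iff_null_sets dest: AE_not_in)
  then have "AE g in lborel. w \<bullet> g \<noteq> b \<bullet> L h"
    by (simp add: AE_completion_iff)
  then show ?thesis
    by eventually_elim (auto simp: w inner_commute[of w])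
qed

text \<open>The affine family \<open>a + L g\<close> makes the induction go through: fixing an
  answer confines \<open>g\<close> to a hyperplane, which \<open>proj_orth y\<close> parametrises as
  another such family. A query costs at most one dimension of the range, and the positive dimension
  left at the end defeats a constant guess.\<close>

lemma adaptive_AE_neq:
  fixes F :: "'a::euclidean_space \<Rightarrow> 'a" and L :: "'a \<Rightarrow> 'a"
  assumes "adaptive r F" "linear L" "r < dim (range L)"
    and "{g. F (a + L g) \<noteq> a + L g} \<in> sets borel"
  shows "AE g in lborel. F (a + L g) \<noteq> a + L g"
  using assms
proof (induction arbitrary: a L rule: adaptive.induct)
  case (const b)
  then show ?case
    using AE_linear_neq[of L "b - a"] by (auto simp: algebra_simps elim!: eventually_mono)
next
  case (query r G x)
  define y where "y = adjoint L x"
  have y: "x \<bullet> L g = y \<bullet> g" for g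
    using query.prems(1) by (simp add: y_def adjoint_works inner_commute)
  show ?case
  proof (cases "y = 0")
    \<comment> \<open>The answer is \<open>x \<bullet> a\<close> on the whole family, so
      \<open>L\<close> is kept.\<close>
    case True
    then show ?thesis
      using query.IH[of L "x \<bullet> a" a] query.prems by (simp add: inner_add_right y)
  next
    case False
    show ?thesis
    proof (rule AE_lborel_hyperplane_sections[OF query.prems(3), where y = y])
      fix t :: real
      \<comment> \<open>On this slice the answer is the constant \<open>?c\<close>, because
        \<open>proj_orth y g\<close> is orthogonal to \<open>y\<close>; what follows is the fixed
        strategy \<open>G ?c\<close>.\<close>
      let ?c = "x \<bullet> a + t * (y \<bullet> y)" and ?L = "L \<circ> proj_orth y" and ?a = "a + t *\<^sub>R L y"
      have z: "a + L (proj_orth y g + t *\<^sub>R y) = ?a + ?L g" for g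
        using query.prems(1) by (simp add: linear_add linear_scale)
      have c: "x \<bullet> (?a + ?L g) = ?c" for g
        by (simp add: inner_add_right y inner_proj_orth)
      have "(\<lambda>g. proj_orth y g + t *\<^sub>R y) \<in> borel_measurable borel"
        by (intro borel_measurable_continuous_onI continuous_intros linear_continuous_on
          linear_conv_bounded_linear[THEN iffD1] linear_proj_orth)
      from measurable_sets[OF this query.prems(3)]
      have "{g. G ?c (?a + ?L g) \<noteq> ?a + ?L g} \<in> sets borel"
        unfolding vimage_def mem_Collect_eq z c by simp
      moreover have "linear ?L"
        using query.prems(1) linear_proj_orth by (rule linear_compose[rotated])
      moreover have "r < dim (range ?L)"
        using dim_range_proj_orth[OF query.prems(1), of y] query.prems(2) by simp
      ultimately have "AE g in lborel. G ?c (?a + ?L g) \<noteq> ?a + ?L g"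
        using query.IH by blast
      then show "AE g in lborel. G (x \<bullet> (a + L (proj_orth y g + t *\<^sub>R y)))
          (a + L (proj_orth y g + t *\<^sub>R y)) \<noteq> a + L (proj_orth y g + t *\<^sub>R y)"
        unfolding z c .
    qed
  qed
qed

section \<open>Runs on matrices with a single nonzero row\<close>

definition row_matrix :: "'m \<Rightarrow> real^'n \<Rightarrow> real^'n^'m" where
  "row_matrix i v = axis i v"

lemma row_matrix_mult: "row_matrix i v *v x = axis i (x \<bullet> v)"
  by (auto simp: row_matrix_def vec_eq_iff matrix_vector_mul_component axis_def inner_commute)

lemma rank_row_matrix: "rank (row_matrix i v) \<le> 1"
proof -
  have "range ((*v) (row_matrix i v)) \<subseteq> span {axis i 1}"
    by (auto simp: row_matrix_mult span_singleton axis_def vec_eq_iff)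
  then have "dim (range ((*v) (row_matrix i v))) \<le> card {axis i (1::real)}"
    by (intro dim_le_card) auto
  then show ?thesis by (simp add: rank_dim_range)
qed

text \<open>A run appends queries at the end, whereas \<open>adaptive\<close> peels them off at the
  front. Letting \<open>H\<close> spend \<open>r\<close> further inner products bridges this: the
  induction on \<open>q\<close> absorbs the last query into \<open>H\<close>.\<close>

lemma adaptive_run_transcript:
  fixes alg :: "('s, 'm::finite, 'n::finite) matvec_alg"
  assumes "\<And>t. adaptive r (H t)"
  shows "adaptive (r + q) (\<lambda>v. H (run_transcript alg (row_matrix i v) s q) v)"
  using assms
proof (induction q arbitrary: r H)
  case 0
  then show ?case by simp
next
  case (Suc q)
  define H' where "H' t v =
    H (t(q := (next_query alg q s t, axis i (next_query alg q s t \<bullet> v)))) v" for t v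
  have "adaptive (Suc r) (H' t)" for t
    using adaptive.query[of r "\<lambda>c. H (t(q := (next_query alg q s t, axis i c)))"] Suc.prems
    by (simp add: H'_def[abs_def])
  from Suc.IH[of "Suc r" H', OF this] show ?case
    unfolding H'_def run_transcript.simps Let_def row_matrix_mult by (simp add: fun_upd_def)
qed

text \<open>Fubini over seed and row needs measurability in both jointly.\<close>

lemma run_transcript_row_matrix_measurable:
  fixes alg :: "('s, 'm::finite, 'n::finite) matvec_alg"
  assumes "randomized_matvec_alg alg" "q \<le> num_queries alg"
  shows "(\<lambda>(s, v). run_transcript alg (row_matrix i v) s q)
    \<in> seed alg \<Otimes>\<^sub>M lborel \<rightarrow>\<^sub>M transcript_space q"
  using assms(2)
proof (induction q)
  case 0
  show ?case by (simp add: transcript_space_def space_PiM)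
next
  case (Suc q)
  let ?M = "seed alg \<Otimes>\<^sub>M (lborel :: (real^'n) measure)"
  let ?t = "\<lambda>p. run_transcript alg (row_matrix i (snd p)) (fst p) q"
  have t: "?t \<in> ?M \<rightarrow>\<^sub>M transcript_space q"
    using Suc by (simp add: case_prod_beta')
  have "(\<lambda>(s, t). next_query alg q s t) \<in> seed alg \<Otimes>\<^sub>M transcript_space q \<rightarrow>\<^sub>M borel"
    using assms(1) Suc.prems by (simp add: randomized_matvec_alg_def)
  from measurable_compose[OF measurable_Pair[OF measurable_fst t] this]
  have x: "(\<lambda>p. next_query alg q (fst p) (?t p)) \<in> ?M \<rightarrow>\<^sub>M borel" by simp
  have "(\<lambda>c. c *\<^sub>R axis i (1 :: real)) \<in> borel_measurable (borel :: real measure)"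
    by measurable
  also have "(\<lambda>c :: real. c *\<^sub>R axis i (1 :: real)) = axis i"
    by (auto simp: axis_def vec_eq_iff)
  finally have axis: "axis i \<in> borel_measurable (borel :: real measure)" .
  have "(\<lambda>p. next_query alg q (fst p) (?t p) \<bullet> snd p) \<in> ?M \<rightarrow>\<^sub>M borel"
    using x by (intro borel_measurable_inner) auto
  note p = measurable_Pair[OF x measurable_compose[OF this axis]]
  show ?case
    unfolding run_transcript.simps Let_def transcript_space_def row_matrix_mult case_prod_beta'
    by (rule measurable_fun_upd[where J = "{..<q}" and i = q])
      (use p t in \<open>auto simp: lessThan_Suc transcript_space_def\<close>)
qed

lemma run_output_row_matrix_measurable:
  fixes alg :: "('s, 'm::finite, 'n::finite) matvec_alg"
  assumes "randomized_matvec_alg alg"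
  shows "(\<lambda>(s, v). run_output alg (row_matrix i v) s) \<in> seed alg \<Otimes>\<^sub>M lborel \<rightarrow>\<^sub>M borel"
proof -
  have "(\<lambda>(s, t). answer alg s t) \<in> seed alg \<Otimes>\<^sub>M transcript_space (num_queries alg) \<rightarrow>\<^sub>M borel"
    using assms by (simp add: randomized_matvec_alg_def)
  from measurable_compose[OF measurable_Pair[OF measurable_fst
      run_transcript_row_matrix_measurable[OF assms order_refl]] this]
  show ?thesis by (simp add: run_output_def case_prod_beta')
qed

lemma success_event_exact:
  assumes "rank A \<le> k" "s \<in> success_event alg k \<gamma> A"
  shows "run_output alg A s = A"
proof -
  have "is_best_rank_approx k A A"
    using assms(1) by (auto simp: is_best_rank_approx_def frobenius_norm_eq_norm)
  from is_best_rank_approx_error[OF this] assms(2) show ?thesis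
    by (simp add: success_event_def frobenius_norm_eq_norm)
qed

theorem theorem5p1:
  fixes alg :: "('s, 'm::finite, 'n::finite) matvec_alg"
    and k :: nat and \<gamma> :: real
  assumes "CARD('m) \<le> CARD('n)"
    and "1 \<le> k" and "k \<le> CARD('m)"
    and "1 < \<gamma>"
    and "randomized_matvec_alg alg"
    and "\<And>A :: real^'n^'m. measure (seed alg) (success_event alg k \<gamma> A) \<ge> 2/3"
  shows "CARD('n) \<le> num_queries alg"
proof (rule ccontr)
  assume "\<not> CARD('n) \<le> num_queries alg"
  then have few: "num_queries alg < dim (range (\<lambda>v :: real^'n. v))"
    by (simp add: dim_UNIV)
  interpret seed: prob_space "seed alg"
    using assms(5) by (simp add: randomized_matvec_alg_def)
  interpret pair_sigma_finite "seed alg" "lborel :: (real^'n) measure"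
    by unfold_locales
  obtain i :: 'm where True by simp
  \<comment> \<open>Reading off row \<open>i\<close> gives a guess for \<open>v\<close> itself, the
    form required by \<open>adaptive_AE_neq\<close>.\<close>
  define out where "out s v = run_output alg (row_matrix i v) s $ i" for s v
  have out: "case_prod out \<in> seed alg \<Otimes>\<^sub>M lborel \<rightarrow>\<^sub>M borel"
    using measurable_compose[OF run_output_row_matrix_measurable[OF assms(5), of i]
      borel_measurable_continuous_onI[of "\<lambda>B :: real^'n^'m. B $ i"]]
    by (simp add: out_def case_prod_beta' continuous_on_component)
  have "AE v in lborel. out s v \<noteq> v" if s: "s \<in> space (seed alg)" for s
  proof -
    have "adaptive (num_queries alg) (out s)"
      using adaptive_run_transcript[of 0 "\<lambda>t _. answer alg s t $ i", OF adaptive.const]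
      by (simp add: out_def[abs_def] run_output_def)
    moreover have [measurable]: "out s \<in> borel_measurable borel"
      using measurable_Pair2[OF out s] by simp
    have "{v. out s (0 + v) \<noteq> 0 + v} \<in> sets borel" by measurable
    ultimately show ?thesis
      using adaptive_AE_neq[of _ "out s" "\<lambda>v. v" 0] few by (simp add: linear_id[unfolded id_def])
  qed
  then have "AE s in seed alg. AE v in lborel. out s v \<noteq> v" by simp
  moreover have [measurable]: "(\<lambda>p. out (fst p) (snd p)) \<in> seed alg \<Otimes>\<^sub>M lborel \<rightarrow>\<^sub>M borel"
    using out by (simp add: case_prod_beta')
  have "{p \<in> space (seed alg \<Otimes>\<^sub>M lborel). out (fst p) (snd p) \<noteq> snd p}
      \<in> sets (seed alg \<Otimes>\<^sub>M lborel)"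
    by measurable
  \<comment> \<open>The exchange yields a single hard input: one \<open>v\<close> missed by almost
    every seed.\<close>
  ultimately have "AE v in lborel. AE s in seed alg. out s v \<noteq> v"
    by (subst (asm) AE_commute) auto
  then obtain v where v: "AE s in seed alg. out s v \<noteq> v"
    using eventually_happens[of _ "ae_filter (lborel :: (real^'n) measure)"]
    by (auto simp: ae_filter_eq_bot_iff)
  \<comment> \<open>Here \<open>1 \<le> k\<close> enters: the single-row matrix has rank at most
    \<open>k\<close>.\<close>
  have "out s v = v" if "s \<in> success_event alg k \<gamma> (row_matrix i v)" for s
    using success_event_exact[OF _ that] rank_row_matrix[of i v] assms(2)
    by (simp add: out_def row_matrix_def)
  with v have "AE s in seed alg. s \<notin> success_event alg k \<gamma> (row_matrix i v)"
    by (auto elim: eventually_mono)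
  then have "measure (seed alg) (success_event alg k \<gamma> (row_matrix i v)) = 0"
    using seed.prob_eq_0 success_event_measurable[OF assms(5)] by blast
  with assms(6)[of "row_matrix i v"] show False by simp
qed

end
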